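(* Let $\mu\in\mathbb{R}$, $\sigma>0$, $r>0$, let $g:\mathbb{R}\to\mathbb{R}$ be continuous, let $m>m_0$ be a fixed integer, $\Delta t=2^{-2m}$, $\Delta x=2^{-m}$, $t_k=k\Delta t$, and $T=N\Delta t$ with $N$ a positive integer. The discrete Feynman--Kac functional $$f_m(t_k,x):=\mathbb{E}_{\mathbb{Q}_m}\left\{r_m^{k-N}g(S_m(T))\,\middle|\,S_m(t_k)=x\right\}\qquad(0\le k\le N,\ x\in\mathbb{R})$$ is the unique solution of the difference equation (for $1\le k\le N$, $x\in\mathbb{R}$) $$\frac{f_m(t_k,x)-f_m(t_{k-1},x)}{\Delta t}+\frac12r_m^{-1}\,\frac{2q_m^+f_m(t_k,x^+)+2q_m^-f_m(t_k,x^-)-2f_m(t_k,x)}{(\Delta x)^2}+\frac{r_m^{-1}-1}{\Delta t}f_m(t_k,x)=0,$$ with the boundary condition $f_m(T,x)=g(x)$, where $x^+:=xu_m$ and $x^-:=xd_m$.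
   Context: $r_m=1+r\Delta t$, $u_m=1+\sigma2^{-m}+\mu2^{-2m}$, $d_m=1-\sigma2^{-m}+\mu2^{-2m}$, $q_m^\pm=\frac12\pm\frac12\frac{r-\mu}{\sigma}2^{-m}$, $m_0=\frac1{\log2}\log\frac{|r-\mu|}{\sigma}$ (so $0<q_m^+<1$ for $m>m_0$). Under $\mathbb{Q}_m$, $S_m$ is the Markov chain with $S_m(t_{k+1})=u_mS_m(t_k)$ with probability $q_m^+$ and $S_m(t_{k+1})=d_mS_m(t_k)$ with probability $q_m^-$, independently at each step (equivalently $S_m(t_{k+1})-S_m(t_k)=rS_m(t_k)\Delta t+\sigma S_m(t_k)\Delta W_m(t_{k+1})$ with $W_m(t_k)=B_m(t_k)+\frac{\mu-r}{\sigma}t_k$, where $B_m$ has independent steps $\pm2^{-m}$ with $\mathbb{Q}_m$-probabilities $q_m^\pm$). The conditional expectation given $S_m(t_k)=x$ means the expectation for the chain started at $x$ at time $t_k$, for any $x\in\mathbb{R}$. *)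

theory Defs
  imports "HOL-Probability.Probability"
begin

definition dx :: "int \<Rightarrow> real" where
  "dx m = 2 powi (- m)"

definition dt :: "int \<Rightarrow> real" where
  "dt m = 2 powi (- 2 * m)"

definition discount :: "real \<Rightarrow> int \<Rightarrow> real" where
  "discount r m = 1 + r * dt m"

definition up_factor :: "real \<Rightarrow> real \<Rightarrow> int \<Rightarrow> real" where
  "up_factor \<mu> \<sigma> m = 1 + \<sigma> * 2 powi (- m) + \<mu> * 2 powi (- 2 * m)"

definition down_factor :: "real \<Rightarrow> real \<Rightarrow> int \<Rightarrow> real" where
  "down_factor \<mu> \<sigma> m = 1 - \<sigma> * 2 powi (- m) + \<mu> * 2 powi (- 2 * m)"

definition q_plus :: "real \<Rightarrow> real \<Rightarrow> real \<Rightarrow> int \<Rightarrow> real" where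
  "q_plus \<mu> \<sigma> r m = 1/2 + 1/2 * ((r - \<mu>) / \<sigma>) * 2 powi (- m)"

definition q_minus :: "real \<Rightarrow> real \<Rightarrow> real \<Rightarrow> int \<Rightarrow> real" where
  "q_minus \<mu> \<sigma> r m = 1/2 - 1/2 * ((r - \<mu>) / \<sigma>) * 2 powi (- m)"

text \<open>In HOL \<open>ln 0 = 0\<close>, so the value \<open>-\<infinity>\<close> for \<open>r = \<mu>\<close> (no restriction on \<open>m\<close>) is made explicit.\<close>

definition m_zero :: "real \<Rightarrow> real \<Rightarrow> real \<Rightarrow> ereal" where
  "m_zero \<mu> \<sigma> r =
     (if r = \<mu> then - \<infinity> else ereal (1 / ln 2 * ln (\<bar>r - \<mu>\<bar> / \<sigma>)))"

text \<open>\<open>\<xi> j\<close> is the factor by which the price is multiplied in the step from time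
  \<open>(j - 1) * dt m\<close> to time \<open>j * dt m\<close>; \<open>Q\<close> is the risk-neutral measure on an
  arbitrary sample space.\<close>

definition risk_neutral_steps ::
  "real \<Rightarrow> real \<Rightarrow> real \<Rightarrow> int \<Rightarrow> nat \<Rightarrow> 'w measure \<Rightarrow> (nat \<Rightarrow> 'w \<Rightarrow> real) \<Rightarrow> bool" where
  "risk_neutral_steps \<mu> \<sigma> r m N Q \<xi> \<longleftrightarrow>
     prob_space Q \<and>
     prob_space.indep_vars Q (\<lambda>_. borel) \<xi> {1..N} \<and>
     (\<forall>j\<in>{1..N}.
        measure Q {\<omega> \<in> space Q. \<xi> j \<omega> = up_factor \<mu> \<sigma> m} = q_plus \<mu> \<sigma> r m \<and>
        measure Q {\<omega> \<in> space Q. \<xi> j \<omega> = down_factor \<mu> \<sigma> m} = q_minus \<mu> \<sigma> r m)"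

text \<open>\<open>chain \<xi> k x n\<close> is the price at time \<open>(k + n) * dt m\<close> of the chain started at \<open>x\<close>
  at time \<open>k * dt m\<close>.\<close>

primrec chain :: "(nat \<Rightarrow> 'w \<Rightarrow> real) \<Rightarrow> nat \<Rightarrow> real \<Rightarrow> nat \<Rightarrow> 'w \<Rightarrow> real" where
  "chain \<xi> k x 0 \<omega> = x"
| "chain \<xi> k x (Suc n) \<omega> = chain \<xi> k x n \<omega> * \<xi> (Suc (k + n)) \<omega>"

text \<open>Functions on the time grid are indexed by \<open>k\<close> instead of \<open>k * dt m\<close>.\<close>

definition feynman_kac ::
  "real \<Rightarrow> int \<Rightarrow> nat \<Rightarrow> (real \<Rightarrow> real) \<Rightarrow> 'w measure \<Rightarrow> (nat \<Rightarrow> 'w \<Rightarrow> real) \<Rightarrow>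
   nat \<Rightarrow> real \<Rightarrow> real" where
  "feynman_kac r m N g Q \<xi> k x =
     (\<integral>\<omega>. discount r m powi (int k - int N) * g (chain \<xi> k x (N - k) \<omega>) \<partial>Q)"

definition solves_difference_equation ::
  "real \<Rightarrow> real \<Rightarrow> real \<Rightarrow> int \<Rightarrow> nat \<Rightarrow> (real \<Rightarrow> real) \<Rightarrow> (nat \<Rightarrow> real \<Rightarrow> real) \<Rightarrow> bool" where
  "solves_difference_equation \<mu> \<sigma> r m N g f \<longleftrightarrow>
     (\<forall>k\<in>{1..N}. \<forall>x.
        (f k x - f (k - 1) x) / dt m
        + 1/2 * inverse (discount r m) *
            ((2 * q_plus \<mu> \<sigma> r m * f k (x * up_factor \<mu> \<sigma> m)
              + 2 * q_minus \<mu> \<sigma> r m * f k (x * down_factor \<mu> \<sigma> m)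
              - 2 * f k x) / (dx m)\<^sup>2)
        + (inverse (discount r m) - 1) / dt m * f k x = 0) \<and>
     (\<forall>x. f N x = g x)"

lemma q_plus_in_unit_interval:
  assumes "\<sigma> > 0" "m_zero \<mu> \<sigma> r < ereal (of_int m)"
  shows "0 < q_plus \<mu> \<sigma> r m" "q_plus \<mu> \<sigma> r m < 1"
proof -
  have "\<bar>r - \<mu>\<bar> / \<sigma> < 2 powi m"
  proof (cases "r = \<mu>")
    case False
    then have pos: "\<bar>r - \<mu>\<bar> / \<sigma> > 0" using assms by simp
    have "ln (\<bar>r - \<mu>\<bar> / \<sigma>) < of_int m * ln 2"
      using assms False by (simp add: m_zero_def field_simps)
    also have "\<dots> = ln (2 powi m)" 
      by (simp add: powr_real_of_int' [symmetric] ln_powr)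
    finally show ?thesis using pos by simp
  qed simp
  then have "\<bar>(r - \<mu>) / \<sigma>\<bar> * 2 powi (- m) < 1"
    using assms by (simp add: power_int_minus field_simps)
  moreover define y where "y = (r - \<mu>) / \<sigma> * 2 powi (- m)"
  ultimately have y: "\<bar>y\<bar> < 1" by (simp add: abs_mult)
  have q: "q_plus \<mu> \<sigma> r m = 1/2 + 1/2 * y"
    by (simp add: q_plus_def y_def)
  show "0 < q_plus \<mu> \<sigma> r m" "q_plus \<mu> \<sigma> r m < 1"
    unfolding q using y by auto
qed

lemma risk_neutral_steps_exist:
  assumes "\<sigma> > 0" "m_zero \<mu> \<sigma> r < ereal (of_int m)"
  shows "\<exists>(Q :: (nat \<Rightarrow> bool) measure) \<xi>. risk_neutral_steps \<mu> \<sigma> r m N Q \<xi>"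
proof -
  let ?p = "bernoulli_pmf (q_plus \<mu> \<sigma> r m)"
  let ?u = "up_factor \<mu> \<sigma> m" and ?d = "down_factor \<mu> \<sigma> m"
  have q_minus_eq: "q_minus \<mu> \<sigma> r m = 1 - q_plus \<mu> \<sigma> r m"
    by (simp add: q_plus_def q_minus_def)
  define P where "P = Pi_pmf {1..N} False (\<lambda>_::nat. ?p)"
  define \<xi> where "\<xi> = (\<lambda>(j::nat) \<omega>. if \<omega> j then ?u else ?d)"
  have ne: "?u \<noteq> ?d" using assms by (simp add: up_factor_def down_factor_def)
  have ind: "prob_space.indep_vars P (\<lambda>_. count_space UNIV) (\<lambda>j \<omega>. \<omega> j) {1..N}"
    unfolding P_def by (rule indep_vars_Pi_pmf) simp
  have "prob_space.indep_vars P (\<lambda>_. borel) (\<lambda>j \<omega>. if \<omega> j then ?u else ?d) {1..N}"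
    by (rule prob_space.indep_vars_compose2[OF prob_space_measure_pmf ind]) simp
  then have 1: "prob_space.indep_vars P (\<lambda>_. borel) \<xi> {1..N}" unfolding \<xi>_def .
  have meas: "measure P {\<omega>. \<omega> j = b} = pmf ?p b" if "j \<in> {1..N}" for j b
  proof -
    have "pmf ?p b = pmf (map_pmf (\<lambda>\<omega>. \<omega> j) P) b"
      unfolding P_def using that by (subst Pi_pmf_component) auto
    also have "\<dots> = measure P {\<omega>. \<omega> j = b}"
      by (simp add: pmf_map vimage_def)
    finally show ?thesis by simp
  qed
  have 2: "measure P {\<omega> \<in> space P. \<xi> j \<omega> = ?u} = q_plus \<mu> \<sigma> r m"
    "measure P {\<omega> \<in> space P. \<xi> j \<omega> = ?d} = q_minus \<mu> \<sigma> r m" if "j \<in> {1..N}" for j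
  proof -
    have "{\<omega> \<in> space P. \<xi> j \<omega> = ?u} = {\<omega>. \<omega> j = True}"
      "{\<omega> \<in> space P. \<xi> j \<omega> = ?d} = {\<omega>. \<omega> j = False}"
      using ne by (auto simp: \<xi>_def split: if_splits)
    then show "measure P {\<omega> \<in> space P. \<xi> j \<omega> = ?u} = q_plus \<mu> \<sigma> r m"
      "measure P {\<omega> \<in> space P. \<xi> j \<omega> = ?d} = q_minus \<mu> \<sigma> r m"
      using meas[OF that, of True] meas[OF that, of False] q_plus_in_unit_interval[OF assms]
        q_minus_eq
      by simp_all
  qed
  show ?thesis
    unfolding risk_neutral_steps_def using prob_space_measure_pmf 1 2 by blast
qed

end

theory Submission imports Defs begin

text \<open>Since \<open>dt m = (dx m)\<^sup>2\<close>, multiplying the difference equation by \<open>dt m\<close> makes the terms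
  in \<open>f k x\<close> cancel and leaves the backward recursion
  \<open>f (k - 1) x = (q\<^sup>+ * f k (x * u) + q\<^sup>- * f k (x * d)) / (1 + r * dt m)\<close>. With the terminal
  condition this determines \<open>f\<close>, and the Feynman--Kac functional satisfies it by conditioning on
  the first step, which is independent of the product of the later ones.\<close>

text \<open>\<open>risk_neutral_steps\<close> prescribes only the masses of two level sets. These
  sets are disjoint and their masses add up to 1, so every other value of a step factor has
  probability 0.\<close>

lemma (in prob_space) AE_two_values:
  fixes X :: "'a \<Rightarrow> real"
  assumes [measurable]: "X \<in> borel_measurable M"
    and "u \<noteq> d"
    and "prob {\<omega> \<in> space M. X \<omega> = u} + prob {\<omega> \<in> space M. X \<omega> = d} = 1"
  shows "AE \<omega> in M. X \<omega> = u \<or> X \<omega> = d"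
proof -
  have "prob ({\<omega> \<in> space M. X \<omega> = u} \<union> {\<omega> \<in> space M. X \<omega> = d}) = 1"
    using assms(2,3) by (subst finite_measure_Union) auto
  then have "AE \<omega> in M. \<omega> \<in> {\<omega> \<in> space M. X \<omega> = u} \<union> {\<omega> \<in> space M. X \<omega> = d}"
    by (intro prob_eq_1[THEN iffD1]) auto
  then show ?thesis by (rule AE_mp) auto
qed

text \<open>This stands in for conditioning on \<open>X\<close>: on the event \<open>X = v\<close>
  the argument \<open>X\<close> is frozen to the constant \<open>v\<close>, and independence lets
  the indicator of that event factor out of the expectation.\<close>

lemma (in prob_space) expectation_two_values_indep:
  fixes X Y :: "'a \<Rightarrow> real" and h :: "real \<times> real \<Rightarrow> real"
  assumes indep: "indep_var borel X borel Y"
    and h [measurable]: "h \<in> borel_measurable borel"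
    and "u \<noteq> d"
    and AE: "AE \<omega> in M. X \<omega> = u \<or> X \<omega> = d"
    and int: "integrable M (\<lambda>\<omega>. h (u, Y \<omega>))" "integrable M (\<lambda>\<omega>. h (d, Y \<omega>))"
  shows "expectation (\<lambda>\<omega>. h (X \<omega>, Y \<omega>)) =
    prob {\<omega> \<in> space M. X \<omega> = u} * expectation (\<lambda>\<omega>. h (u, Y \<omega>)) +
    prob {\<omega> \<in> space M. X \<omega> = d} * expectation (\<lambda>\<omega>. h (d, Y \<omega>))"
proof -
  have [measurable]: "X \<in> borel_measurable M" "Y \<in> borel_measurable M"
    using indep by (auto dest: indep_var_rv1 indep_var_rv2)
  have h' [measurable]: "h \<in> borel_measurable (borel \<Otimes>\<^sub>M borel)"
    using h by (simp add: borel_prod)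
  have part: "integrable M (\<lambda>\<omega>. indicator {v} (X \<omega>) * h (v, Y \<omega>))"
    "expectation (\<lambda>\<omega>. indicator {v} (X \<omega>) * h (v, Y \<omega>)) =
      prob {\<omega> \<in> space M. X \<omega> = v} * expectation (\<lambda>\<omega>. h (v, Y \<omega>))"
    if "integrable M (\<lambda>\<omega>. h (v, Y \<omega>))" for v
  proof -
    have ind: "indep_var borel (\<lambda>\<omega>. indicator {v} (X \<omega>) :: real) borel (\<lambda>\<omega>. h (v, Y \<omega>))"
      using indep_var_compose[OF indep, of "indicator {v}" borel "\<lambda>y. h (v, y)" borel]
      by (simp add: comp_def)
    have int': "integrable M (\<lambda>\<omega>. indicator {v} (X \<omega>) :: real)"
      by (rule integrable_const_bound[of _ 1]) auto
    have "expectation (\<lambda>\<omega>. indicator {v} (X \<omega>) :: real) =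
        expectation (indicator {\<omega> \<in> space M. X \<omega> = v})"
      by (rule Bochner_Integration.integral_cong) (auto simp: indicator_def)
    also have "\<dots> = prob {\<omega> \<in> space M. X \<omega> = v}" by (simp add: Int_absorb1)
    finally show "expectation (\<lambda>\<omega>. indicator {v} (X \<omega>) * h (v, Y \<omega>)) =
      prob {\<omega> \<in> space M. X \<omega> = v} * expectation (\<lambda>\<omega>. h (v, Y \<omega>))"
      using indep_var_lebesgue_integral[OF ind int' that] by simp
    show "integrable M (\<lambda>\<omega>. indicator {v} (X \<omega>) * h (v, Y \<omega>))"
      by (rule indep_var_integrable[OF ind int' that])
  qed
  \<comment> \<open>Almost everywhere exactly one of the two indicators is 1, because
    \<open>u \<noteq> d\<close>.\<close>
  have "expectation (\<lambda>\<omega>. h (X \<omega>, Y \<omega>)) =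
    expectation (\<lambda>\<omega>. indicator {u} (X \<omega>) * h (u, Y \<omega>) + indicator {d} (X \<omega>) * h (d, Y \<omega>))"
    using AE \<open>u \<noteq> d\<close> by (intro integral_cong_AE) auto
  then show ?thesis
    using part[OF int(1)] part[OF int(2)] by simp
qed

text \<open>The starting point enters only as a scalar, and the factors are indexed by absolute
  time. Starting one step earlier therefore just adds one factor to the same product.\<close>

lemma chain_eq_prod: "chain \<xi> k x n \<omega> = x * (\<Prod>j\<in>{k<..k + n}. \<xi> j \<omega>)"
proof (induction n)
  case (Suc n)
  have "{k<..k + Suc n} = insert (Suc (k + n)) {k<..k + n}" by auto
  then show ?case using Suc by (simp add: mult_ac)
qed simp

lemma feynman_kac_eq:
  assumes "k \<le> N"
  shows "feynman_kac r m N g Q \<xi> k x =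
    discount r m powi (int k - int N) * (\<integral>\<omega>. g (x * (\<Prod>j\<in>{k<..N}. \<xi> j \<omega>)) \<partial>Q)"
  using assms by (simp add: feynman_kac_def chain_eq_prod)

text \<open>A growth condition on \<open>g\<close> is replaced by compactness: \<open>Y\<close>
  almost surely stays in a closed ball, on which the continuous \<open>g\<close> is bounded.\<close>

lemma (in prob_space) integrable_continuous_bounded:
  fixes Y :: "'a \<Rightarrow> real" and g :: "real \<Rightarrow> real"
  assumes g: "continuous_on UNIV g" and [measurable]: "Y \<in> borel_measurable M"
    and AE: "AE \<omega> in M. \<bar>Y \<omega>\<bar> \<le> C"
  shows "integrable M (\<lambda>\<omega>. g (Y \<omega>))"
proof -
  have [measurable]: "g \<in> borel_measurable borel"
    using g by (rule borel_measurable_continuous_onI)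
  have "bounded (g ` cball 0 C)"
    by (intro compact_imp_bounded compact_continuous_image continuous_on_subset[OF g]) auto
  then obtain B where "\<forall>y\<in>cball 0 C. \<bar>g y\<bar> \<le> B"
    by (auto simp: bounded_iff)
  then have B: "\<And>y. \<bar>y\<bar> \<le> C \<Longrightarrow> \<bar>g y\<bar> \<le> B" by simp
  show ?thesis
    using AE B by (intro integrable_const_bound[of _ B]) auto
qed

lemma (in prob_space) AE_abs_prod_le:
  fixes X :: "'i \<Rightarrow> 'a \<Rightarrow> real"
  assumes "finite I" and "\<And>i. i \<in> I \<Longrightarrow> AE \<omega> in M. \<bar>X i \<omega>\<bar> \<le> c"
  shows "AE \<omega> in M. \<bar>\<Prod>i\<in>I. X i \<omega>\<bar> \<le> c ^ card I"
proof -
  have "AE \<omega> in M. \<forall>i\<in>I. \<bar>X i \<omega>\<bar> \<le> c"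
    using assms by (intro AE_finite_allI) auto
  then show ?thesis
  proof (rule AE_mp, intro AE_I2 impI)
    fix \<omega> assume "\<forall>i\<in>I. \<bar>X i \<omega>\<bar> \<le> c"
    then have "(\<Prod>i\<in>I. \<bar>X i \<omega>\<bar>) \<le> (\<Prod>i\<in>I. c)" by (intro prod_mono) auto
    then show "\<bar>\<Prod>i\<in>I. X i \<omega>\<bar> \<le> c ^ card I" by (simp add: abs_prod)
  qed
qed

lemma q_plus_add_q_minus: "q_plus \<mu> \<sigma> r m + q_minus \<mu> \<sigma> r m = 1"
  by (simp add: q_plus_def q_minus_def)

lemma feynman_kac_step:
  assumes \<sigma>: "\<sigma> > 0" and r: "r > 0" and g: "continuous_on UNIV g"
    and steps: "risk_neutral_steps \<mu> \<sigma> r m N Q \<xi>"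
    and k: "k \<in> {1..N}"
  shows "feynman_kac r m N g Q \<xi> (k - 1) x = inverse (discount r m) *
    (q_plus \<mu> \<sigma> r m * feynman_kac r m N g Q \<xi> k (x * up_factor \<mu> \<sigma> m) +
     q_minus \<mu> \<sigma> r m * feynman_kac r m N g Q \<xi> k (x * down_factor \<mu> \<sigma> m))"
proof -
  interpret prob_space Q using steps by (simp add: risk_neutral_steps_def)
  let ?u = "up_factor \<mu> \<sigma> m" and ?d = "down_factor \<mu> \<sigma> m"
  \<comment> \<open>Absolute values are taken because the hypotheses do not make the factors
    positive.\<close>
  define c where "c = max \<bar>?u\<bar> \<bar>?d\<bar>"
  define P where "P = (\<lambda>\<omega>. \<Prod>j\<in>{k<..N}. \<xi> j \<omega>)"
  have indep: "indep_vars (\<lambda>_. borel) \<xi> {1..N}"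
    and prob: "\<And>j. j \<in> {1..N} \<Longrightarrow> prob {\<omega> \<in> space Q. \<xi> j \<omega> = ?u} = q_plus \<mu> \<sigma> r m"
      "\<And>j. j \<in> {1..N} \<Longrightarrow> prob {\<omega> \<in> space Q. \<xi> j \<omega> = ?d} = q_minus \<mu> \<sigma> r m"
    using steps by (auto simp: risk_neutral_steps_def)
  have ne: "?u \<noteq> ?d" using \<sigma> by (simp add: up_factor_def down_factor_def)
  have meas: "\<xi> j \<in> borel_measurable Q" if "j \<in> {1..N}" for j
    using indep that by (auto simp: indep_vars_def)
  have AE_\<xi>: "AE \<omega> in Q. \<xi> j \<omega> = ?u \<or> \<xi> j \<omega> = ?d" if "j \<in> {1..N}" for j
    using that prob q_plus_add_q_minus by (intro AE_two_values meas ne) auto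
  have [measurable]: "P \<in> borel_measurable Q"
    unfolding P_def using k by (intro borel_measurable_prod meas) auto
  have "AE \<omega> in Q. \<bar>\<xi> j \<omega>\<bar> \<le> c" if "j \<in> {k<..N}" for j
    using AE_\<xi>[of j] that by (auto simp: c_def elim!: AE_mp)
  then have "AE \<omega> in Q. \<bar>P \<omega>\<bar> \<le> c ^ card {k<..N}"
    unfolding P_def by (intro AE_abs_prod_le) auto
  \<comment> \<open>The scalar \<open>x * v\<close> is absorbed into the continuous function, so the
    bound on \<open>P\<close> serves every \<open>v\<close>, in particular both step
    factors.\<close>
  then have int: "integrable Q (\<lambda>\<omega>. g (x * v * P \<omega>))" for v
    by (intro integrable_continuous_bounded[of "\<lambda>y. g (x * v * y)" P, OF _ _ ]
        continuous_on_compose2[OF g] continuous_intros) auto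
  \<comment> \<open>\<open>P\<close> uses only indices above \<open>k\<close>. For
    \<open>k = N\<close> it is the empty product 1.\<close>
  have "indep_var borel (\<xi> k) borel P"
    unfolding P_def using k by (intro indep_vars_prod indep_vars_subset[OF indep]) auto
  moreover have "(\<lambda>(y, z). g (x * y * z)) \<in> borel_measurable borel"
    unfolding case_prod_beta
    by (intro borel_measurable_continuous_onI continuous_on_compose2[OF g] continuous_intros) auto
  ultimately have E: "expectation (\<lambda>\<omega>. g (x * \<xi> k \<omega> * P \<omega>)) =
      q_plus \<mu> \<sigma> r m * expectation (\<lambda>\<omega>. g (x * ?u * P \<omega>)) +
      q_minus \<mu> \<sigma> r m * expectation (\<lambda>\<omega>. g (x * ?d * P \<omega>))"
    using expectation_two_values_indep[of "\<xi> k" P "\<lambda>(y, z). g (x * y * z)" ?u ?d]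
      ne AE_\<xi>[OF k] int prob[OF k] by simp
  have "{k - 1<..N} = insert k {k<..N}" using k by auto
  then have "(\<Prod>j\<in>{k - 1<..N}. \<xi> j \<omega>) = \<xi> k \<omega> * P \<omega>" for \<omega>
    by (simp add: P_def)
  then have F: "feynman_kac r m N g Q \<xi> (k - 1) x = discount r m powi (int (k - 1) - int N) *
      expectation (\<lambda>\<omega>. g (x * \<xi> k \<omega> * P \<omega>))"
    using k by (subst feynman_kac_eq) (auto simp: mult.assoc)
  have "discount r m > 0"
    using r by (simp add: discount_def dt_def add_pos_nonneg)
  \<comment> \<open>Going back one step costs one more discount factor. Here
    \<open>k \<ge> 1\<close> makes the natural subtraction exact, and a nonzero base allows the
    exponents to be split.\<close>
  then have D: "discount r m powi (int (k - 1) - int N) =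
      inverse (discount r m) * discount r m powi (int k - int N)"
    using k power_int_add[of "discount r m" "- 1" "int k - int N"]
    by (simp add: of_nat_diff power_int_minus algebra_simps)
  show ?thesis
    unfolding F D E using k
    by (simp add: feynman_kac_eq P_def algebra_simps)
qed

text \<open>Over the common denominator \<open>dt m\<close>, the coefficients of \<open>a\<close>
  are \<open>1\<close>, \<open>- R\<close> and \<open>R - 1\<close>, with sum 0. This is pure
  algebra in \<open>R\<close>, \<open>p\<close> and \<open>q\<close>.\<close>

lemma difference_equation_iff:
  fixes a :: real
  shows "(a - b) / dt m + 1/2 * R * ((2 * p * y + 2 * q * z - 2 * a) / (dx m)\<^sup>2)
      + (R - 1) / dt m * a = 0 \<longleftrightarrow> b = R * (p * y + q * z)"
proof -
  have "dt m = (dx m)\<^sup>2"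
    by (simp add: dt_def dx_def power2_eq_square flip: power_int_add)
  moreover have "dt m \<noteq> 0" by (simp add: dt_def)
  ultimately have "(a - b) / dt m + 1/2 * R * ((2 * p * y + 2 * q * z - 2 * a) / (dx m)\<^sup>2)
      + (R - 1) / dt m * a = (R * (p * y + q * z) - b) / dt m"
    by (simp add: divide_simps) (simp add: algebra_simps)
  with \<open>dt m \<noteq> 0\<close> show ?thesis by auto
qed

theorem lemma12:
  fixes \<mu> \<sigma> r :: real and g :: "real \<Rightarrow> real" and m :: int and N :: nat
    and Q :: "'w measure" and \<xi> :: "nat \<Rightarrow> 'w \<Rightarrow> real"
  assumes "\<sigma> > 0" and "r > 0"
    and "continuous_on UNIV g"
    and "m_zero \<mu> \<sigma> r < ereal (of_int m)"
    and "N \<ge> 1"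
    and "risk_neutral_steps \<mu> \<sigma> r m N Q \<xi>"
  shows "solves_difference_equation \<mu> \<sigma> r m N g (feynman_kac r m N g Q \<xi>) \<and>
    (\<forall>f. solves_difference_equation \<mu> \<sigma> r m N g f \<longrightarrow>
         (\<forall>k\<le>N. \<forall>x. f k x = feynman_kac r m N g Q \<xi> k x))"
proof -
  note step = feynman_kac_step[OF assms(1,2,3,6)]
  interpret prob_space Q using assms(6) by (simp add: risk_neutral_steps_def)
  \<comment> \<open>At \<open>k = N\<close> the chain has made no step and the discount exponent is
    0, so the integrand is the constant \<open>g x\<close>.\<close>
  have final: "feynman_kac r m N g Q \<xi> N x = g x" for x
    by (simp add: feynman_kac_def prob_space)
  have "f k x = feynman_kac r m N g Q \<xi> k x"
    if f: "solves_difference_equation \<mu> \<sigma> r m N g f" and "k \<le> N" for f k x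
    using \<open>k \<le> N\<close>
  \<comment> \<open>The induction runs downwards from the terminal time: the equation at
    \<open>Suc k\<close> fixes the values at \<open>k\<close>. The point \<open>x\<close> must stay
    arbitrary, since the hypothesis is used at \<open>x\<close> times each factor.\<close>
  proof (induction k arbitrary: x rule: inc_induct)
    case base
    then show ?case using f final by (simp add: solves_difference_equation_def)
  next
    case (step k)
    then have "Suc k \<in> {1..N}" by simp
    with f feynman_kac_step[OF assms(1,2,3,6) this] step.IH show ?case
      unfolding solves_difference_equation_def difference_equation_iff
      by (metis diff_Suc_1)
  qed
  then show ?thesis
    unfolding solves_difference_equation_def difference_equation_iff
    using step final by blast
qed

end
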